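(* For all integers $k \ge 3$, $p(Q_{2k} \setminus v) \ge k^2+k-2 = (k-1)(k+2)$.
   Context: For $n\ge 1$, $Q_n$ is the $n$-dimensional hypercube: the graph with vertex set $\{0,1\}^n$ and edges between vertices differing in exactly one coordinate. $Q_d\setminus v$ denotes the graph obtained from $Q_d$ by deleting one vertex together with its incident edges; by symmetry it does not depend, up to isomorphism, on the choice. An embedding of a graph $G$ in $Q_n$ is any subgraph of $Q_n$ isomorphic to $G$. Given a set of $r$ colors, a $G$-polychromatic $r$-coloring of $Q_n$ is an assignment of one of the $r$ colors to each edge of $Q_n$ such that every embedding of $G$ in $Q_n$ contains an edge of every one of the $r$ colors. The polychromatic number $p(G)$ is the largest integer $r$ such that for every $n$ for which $Q_n$ contains an embedding of $G$, there is a $G$-polychromatic $r$-coloring of $Q_n$. *)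

theory Defs
  imports Main
begin

record 'a ugraph =
  verts :: "'a set"
  edges :: "'a set set"

definition simple_graph :: "'a ugraph \<Rightarrow> bool" where
  "simple_graph G \<longleftrightarrow> (\<forall>e\<in>edges G. e \<subseteq> verts G \<and> card e = 2)"

definition subgraph :: "'a ugraph \<Rightarrow> 'a ugraph \<Rightarrow> bool" where
  "subgraph H G \<longleftrightarrow> simple_graph H \<and> verts H \<subseteq> verts G \<and> edges H \<subseteq> edges G"

definition isomorphic :: "'a ugraph \<Rightarrow> 'b ugraph \<Rightarrow> bool" where
  "isomorphic G H \<longleftrightarrow>
     (\<exists>f. bij_betw f (verts G) (verts H) \<and>
          (\<forall>u\<in>verts G. \<forall>v\<in>verts G. {u, v} \<in> edges G \<longleftrightarrow> {f u, f v} \<in> edges H))"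

definition delete_vertex :: "'a ugraph \<Rightarrow> 'a \<Rightarrow> 'a ugraph" where
  "delete_vertex G v = \<lparr>verts = verts G - {v}, edges = {e \<in> edges G. v \<notin> e}\<rparr>"

definition hypercube :: "nat \<Rightarrow> bool list ugraph" where
  "hypercube n =
     \<lparr>verts = {u. length u = n},
      edges = {{u, v} |u v. length u = n \<and> length v = n \<and>
                            card {i. i < n \<and> u ! i \<noteq> v ! i} = 1}\<rparr>"

definition embedding :: "'a ugraph \<Rightarrow> nat \<Rightarrow> bool list ugraph \<Rightarrow> bool" where
  "embedding G n H \<longleftrightarrow> subgraph H (hypercube n) \<and> isomorphic G H"

definition polychromatic_coloring ::
    "'a ugraph \<Rightarrow> nat \<Rightarrow> nat \<Rightarrow> (bool list set \<Rightarrow> nat) \<Rightarrow> bool" where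
  "polychromatic_coloring G r n c \<longleftrightarrow>
     (\<forall>e\<in>edges (hypercube n). c e < r) \<and>
     (\<forall>H. embedding G n H \<longrightarrow> (\<forall>i<r. \<exists>e\<in>edges H. c e = i))"

(* GREATEST is only meaningful if the admissible r are bounded. This is the case whenever G
   has finitely many edges and embeds in some hypercube Q_n with n >= 1, since then r is at most
   the number of edges of G. *)
definition polychromatic_number :: "'a ugraph \<Rightarrow> nat" where
  "polychromatic_number G =
     (GREATEST r. \<forall>n\<ge>1. (\<exists>H. embedding G n H) \<longrightarrow> (\<exists>c. polychromatic_coloring G r n c))"

end

(*
  Colour an edge by the numbers l and r of ones to the left and to the right of its direction:
  the first component is T mod (k - 1) with T = l + r, the second is
  l + 2 (T div (k - 1)) mod (k + 2).

  An embedded copy of the punctured cube is a subcube minus a vertex. In its k-th free direction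
  there are k - 1 free coordinates to the left and k to the right, so up to a translation (l, r)
  runs through the grid {0..k-1} x {0..k}, which contains all colours. Deleting a vertex can only
  remove a grid point realised by a single edge, i.e. a corner, and every colour but two also
  occurs away from the corners. The exceptions sit at (k - 1, 0) and (0, k). If the deleted
  vertex removes one of those corners, the (k + 1)-st free direction, with grid
  {0..k} x {0..k-1}, supplies the missing colour: the deleted vertex may remove a corner of this
  grid as well, but that corner has another value of T mod (k - 1).
*)
theory Submission
  imports Defs
begin

section \<open>The two-component colour and its behaviour under translation\<close>

text \<open>The two components are the digits of one number in the mixed base
  \<open>(k - 1, k + 2)\<close>, so that colours are natural numbers and can be decoded by
  \<open>div\<close> and \<open>mod\<close>.\<close>

definition edge_color :: "nat \<Rightarrow> nat \<Rightarrow> nat \<Rightarrow> nat" where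
  "edge_color k l r =
     ((l + r) mod (k - 1)) * (k + 2) + (l + 2 * ((l + r) div (k - 1))) mod (k + 2)"

lemma edge_color_less:
  assumes "k \<ge> 2"
  shows "edge_color k l r < (k - 1) * (k + 2)"
proof -
  have "(l + r) mod (k - 1) < k - 1"
    using assms by simp
  then have "Suc ((l + r) mod (k - 1)) * (k + 2) \<le> (k - 1) * (k + 2)"
    by (intro mult_le_mono1) simp
  moreover have "(l + 2 * ((l + r) div (k - 1))) mod (k + 2) < k + 2"
    by simp
  ultimately show ?thesis
    unfolding edge_color_def by (simp only: mult_Suc)
qed

lemma ex_residue_shift:
  fixes a m c :: nat
  assumes "c < m"
  shows "\<exists>t<m. (a + t) mod m = c"
proof -
  have "(a + (c + (m - a mod m)) mod m) mod m = (a mod m + (c + (m - a mod m))) mod m"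
    by (simp add: mod_simps)
  also have "a mod m + (c + (m - a mod m)) = c + m"
    using assms mod_less_divisor[of m a] by linarith
  finally show ?thesis
    using assms by (intro exI[of _ "(c + (m - a mod m)) mod m"]) auto
qed

text \<open>Here \<open>b\<close> and \<open>b'\<close> count the ones in the fixed coordinates of a subcube, while
  \<open>x\<close> and \<open>y\<close> count those in its free coordinates.\<close>

lemma edge_color_shift:
  assumes k: "k \<ge> 2"
    and t: "(b + b' + t) mod (k - 1) = c"
    and s: "(b + 2 * ((b + b' + t) div (k - 1)) + s) mod (k + 2) = d"
    and xy: "x + y = t + j * (k - 1)" "(x + 2 * j) mod (k + 2) = s"
  shows "edge_color k (b + x) (b' + y) = c * (k + 2) + d"
proof -
  let ?q = "(b + b' + t) div (k - 1)"
  have sum: "(b + x) + (b' + y) = (b + b' + t) + j * (k - 1)"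
    using xy by simp
  \<comment> \<open>Adding \<open>j * (k - 1)\<close> to the total keeps its residue and raises its
    quotient by \<open>j\<close>, which the second component counts twice. This is the source of the
    term \<open>x + 2 * j\<close>.\<close>
  have "(b + b' + t + j * (k - 1)) div (k - 1) = j + ?q"
    using k by simp
  moreover have "(b + x + 2 * (j + ?q)) mod (k + 2) = (b + 2 * ?q + (x + 2 * j)) mod (k + 2)"
    by (simp add: algebra_simps)
  moreover have "\<dots> = d"
    using s xy(2) by (metis mod_add_right_eq)
  ultimately show ?thesis
    unfolding edge_color_def sum using t by simp
qed

section \<open>Grid points that realise a prescribed colour\<close>

text \<open>The points \<open>(x, y)\<close> of the grid for which a pair of subsets of sizes \<open>x\<close> and \<open>y\<close> of given
  sets of sizes \<open>a\<close> and \<open>b\<close> is unique.\<close>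

definition corner :: "nat \<Rightarrow> nat \<Rightarrow> nat \<Rightarrow> nat \<Rightarrow> bool" where
  "corner a b x y \<longleftrightarrow> (x = 0 \<or> x = a) \<and> (y = 0 \<or> y = b)"

lemma mod_eq_add: "n = m + s \<Longrightarrow> s < m \<Longrightarrow> n mod m = (s::nat)"
  by simp

text \<open>The line \<open>j = 0\<close> serves \<open>s \<le> t\<close> and the line
  \<open>j = 1\<close> serves \<open>s > t\<close>. For \<open>t = 0\<close> this rule would pick
  the corner \<open>(0, 0)\<close> when \<open>s = 0\<close> and leave the grid when
  \<open>s = 1\<close>; there \<open>j = 2\<close> is used, with \<open>x + 4\<close> wrapping
  around \<open>k + 2\<close>. The line \<open>j = 1\<close> meets a corner only at
  \<open>(k - 1, 0)\<close> for \<open>t = 0\<close> and at \<open>(0, k)\<close> for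
  \<open>t = 1\<close>, hence the two exceptions.\<close>

lemma cells_middle:
  fixes k t s :: nat
  assumes k: "k \<ge> 3" and t: "t < k - 1" and s: "s < k + 2"
  shows "\<exists>j x y. x \<le> k - 1 \<and> y \<le> k \<and> x + y = t + j * (k - 1) \<and> (x + 2 * j) mod (k + 2) = s \<and>
    (\<not> corner (k - 1) k x y \<or> t = 0 \<and> x = k - 1 \<and> y = 0 \<or> t = 1 \<and> x = 0 \<and> y = k)"
proof -
  consider "t = 0" "s = 0" | "t = 0" "s = 1" | "t \<ge> 1" "s \<le> t" | "s \<ge> 2" "t < s"
    using t s by linarith
  then show ?thesis
  proof cases
    case 1
    then show ?thesis using k
      by (intro exI[of _ 2] exI[of _ "k - 2"] exI[of _ k]) (auto simp: corner_def)
  next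
    case 2
    then show ?thesis using k
      by (intro exI[of _ 2] exI[of _ "k - 1"] exI[of _ "k - 1"])
        (auto simp: corner_def intro!: mod_eq_add)
  next
    case 3
    then have "\<not> corner (k - 1) k s (t - s)"
      unfolding corner_def using t by linarith
    then show ?thesis using 3 k t
      by (intro exI[of _ 0] exI[of _ s] exI[of _ "t - s"]) simp
  next
    case 4
    then have "\<not> corner (k - 1) k (s - 2) (t + k + 1 - s) \<or>
        t = 0 \<and> s - 2 = k - 1 \<and> t + k + 1 - s = 0 \<or> t = 1 \<and> s - 2 = 0 \<and> t + k + 1 - s = k"
      unfolding corner_def using t s k by linarith
    moreover have "s - 2 + 2 * 1 = s" "s - 2 \<le> k - 1" "t + k + 1 - s \<le> k"
      "s - 2 + (t + k + 1 - s) = t + 1 * (k - 1)"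
      using 4 t s k by linarith+
    ultimately show ?thesis using s
      by (intro exI[of _ 1] exI[of _ "s - 2"] exI[of _ "t + k + 1 - s"]) simp
  qed
qed

text \<open>Serves the first exception of \<open>cells_middle\<close>. The point
  \<open>(k, 0)\<close> is avoided because its coordinate sum \<open>k\<close> is not a multiple of
  \<open>k - 1\<close>.\<close>

lemma cells_next_0:
  fixes k s :: nat
  assumes k: "k \<ge> 3" and s: "s < k + 2"
  shows "\<exists>j x y. x \<le> k \<and> y \<le> k - 1 \<and> x + y = j * (k - 1) \<and> (x + 2 * j) mod (k + 2) = s \<and>
    (x \<noteq> k \<or> y \<noteq> 0)"
proof -
  consider "s = 0" | "s = 1" | "s \<ge> 2"
    by linarith
  then show ?thesis
  proof cases
    case 1
    then show ?thesis using k
      by (intro exI[of _ 0]) auto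
  next
    case 2
    then show ?thesis using k
      by (intro exI[of _ 2] exI[of _ "k - 1"] exI[of _ "k - 1"]) (auto intro!: mod_eq_add)
  next
    case 3
    then show ?thesis using k s
      by (intro exI[of _ 1] exI[of _ "s - 2"] exI[of _ "k + 1 - s"]) auto
  qed
qed

text \<open>Serves the second exception. The point \<open>(0, k - 1)\<close> is avoided because its
  coordinate sum is 0, not 1, modulo \<open>k - 1\<close>.\<close>

lemma cells_next_1:
  fixes k s :: nat
  assumes k: "k \<ge> 3" and s: "s < k + 2"
  shows "\<exists>j x y. x \<le> k \<and> y \<le> k - 1 \<and> x + y = 1 + j * (k - 1) \<and> (x + 2 * j) mod (k + 2) = s \<and>
    (x \<noteq> 0 \<or> y \<noteq> k - 1)"
proof -
  consider "s = 0" | "s = 1" | "s = 2" | "s \<ge> 3"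
    by linarith
  then show ?thesis
  proof cases
    case 1
    then show ?thesis using k
      by (intro exI[of _ 0] exI[of _ 0] exI[of _ 1]) auto
  next
    case 2
    then show ?thesis using k
      by (intro exI[of _ 0] exI[of _ 1] exI[of _ 0]) auto
  next
    case 3
    then show ?thesis using k
      by (intro exI[of _ 2] exI[of _ k] exI[of _ "k - 1"]) (auto intro!: mod_eq_add)
  next
    case 4
    then show ?thesis using k s
      by (intro exI[of _ 1] exI[of _ "s - 2"] exI[of _ "k + 2 - s"]) auto
  qed
qed

section \<open>Subsets of prescribed sizes avoiding a given set\<close>

text \<open>A subset that is neither empty nor full is not determined by its size: exchanging an
  element inside for one outside gives a second candidate, and \<open>W\<close> can equal only one
  of them.\<close>

lemma ex_subset_card_avoiding:
  assumes fin: "finite L" and x: "x \<le> card L" and av: "\<not> (x = 0 \<or> x = card L)"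
  shows "\<exists>S\<subseteq>L. card S = x \<and> S \<noteq> W"
proof -
  obtain S where S: "S \<subseteq> L" "card S = x"
    using obtain_subset_with_card_n[OF x] by metis
  have finS: "finite S"
    using S fin finite_subset by blast
  obtain a where a: "a \<in> S"
    using S av by fastforce
  obtain b where b: "b \<in> L" "b \<notin> S"
  proof -
    have "S \<noteq> L"
      using S av by auto
    then show ?thesis
      using S that by blast
  qed
  have "card (insert b (S - {a})) = x"
    using a b S finS card_Suc_Diff1[OF finS a] by simp
  moreover have "insert b (S - {a}) \<noteq> S" "insert b (S - {a}) \<subseteq> L"
    using b S by auto
  ultimately show ?thesis
    using S by metis
qed

text \<open>If the sizes of \<open>W\<close> differ from \<open>(x, y)\<close>, any choice works.
  Otherwise the point is not a corner, so one of the two parts can be exchanged.\<close>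

lemma ex_pair_subset_card_avoiding:
  assumes fin: "finite L" "finite R" and disj: "L \<inter> R = {}"
    and x: "x \<le> card L" and y: "y \<le> card R"
    and av: "\<not> (corner (card L) (card R) x y \<and> card (W \<inter> L) = x \<and> card (W \<inter> R) = y)"
  shows "\<exists>S\<subseteq>L \<union> R. card (S \<inter> L) = x \<and> card (S \<inter> R) = y \<and> S \<noteq> W"
proof -
  have *: ?thesis if "A \<subseteq> L" "B \<subseteq> R" "card A = x" "card B = y" "A \<noteq> W \<inter> L \<or> B \<noteq> W \<inter> R" for A B
  proof -
    have "(A \<union> B) \<inter> L = A" "(A \<union> B) \<inter> R = B"
      using that disj by auto
    then show ?thesis
      using that by (intro exI[of _ "A \<union> B"]) auto
  qed
  obtain A where A: "A \<subseteq> L" "card A = x"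
    using obtain_subset_with_card_n[OF x] by metis
  obtain B where B: "B \<subseteq> R" "card B = y"
    using obtain_subset_with_card_n[OF y] by metis
  consider "card (W \<inter> L) \<noteq> x \<or> card (W \<inter> R) \<noteq> y" | "\<not> (x = 0 \<or> x = card L)"
    | "\<not> (y = 0 \<or> y = card R)"
    using av unfolding corner_def by argo
  then show ?thesis
  proof cases
    case 1
    then show ?thesis using *[of A B] A B by blast
  next
    case 2
    then obtain A' where "A' \<subseteq> L" "card A' = x" "A' \<noteq> W \<inter> L"
      using ex_subset_card_avoiding[OF fin(1) x] by metis
    then show ?thesis using *[of A' B] B by blast
  next
    case 3
    then obtain B' where "B' \<subseteq> R" "card B' = y" "B' \<noteq> W \<inter> R"
      using ex_subset_card_avoiding[OF fin(2) y] by metis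
    then show ?thesis using *[of A B'] A by blast
  qed
qed

lemma ex_nth_element:
  fixes P :: "nat set"
  assumes "finite P" "m < card P"
  shows "\<exists>p\<in>P. card {q \<in> P. q < p} = m \<and> card {q \<in> P. p < q} = card P - Suc m"
  using assms
proof (induction "card P" arbitrary: P m)
  case 0
  then show ?case by simp
next
  case (Suc N)
  define M where "M = Max P"
  have M: "M \<in> P" "\<And>q. q \<in> P \<Longrightarrow> q \<le> M"
    using Suc.prems Max_in[of P] card_gt_0_iff[of P] by (auto simp: M_def)
  have cP: "card (P - {M}) = N"
    using Suc M by simp
  show ?case
  proof (cases "m = N")
    case True
    have 1: "{q \<in> P. q < M} = P - {M}" and 2: "{q \<in> P. M < q} = {}"
      using M(2) by (force simp: order.order_iff_strict)+
    show ?thesis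
      using M(1) True cP Suc.hyps(2) by (intro bexI[of _ M]) (simp_all only: 1 2, simp_all)
  next
    case False
    then have "m < card (P - {M})"
      using Suc cP by simp
    then obtain p where p: "p \<in> P - {M}" "card {q \<in> P - {M}. q < p} = m"
      "card {q \<in> P - {M}. p < q} = N - Suc m"
      using Suc.hyps(1)[of "P - {M}" m] cP Suc.prems by auto
    have pM: "p < M"
      using p(1) M(2)[of p] by auto
    have "{q \<in> P - {M}. q < p} = {q \<in> P. q < p}"
      using pM by auto
    moreover have "{q \<in> P. p < q} = insert M {q \<in> P - {M}. p < q}"
      using pM M by auto
    ultimately show ?thesis
      using p Suc.prems(1) Suc.hyps(2) \<open>m < card (P - {M})\<close> cP
      by (intro bexI[of _ p]) auto
  qed
qed

section \<open>All colours occur on a punctured subcube\<close>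

text \<open>\<open>P\<close> is the set of free coordinates of the subcube, \<open>D\<close> the set of fixed coordinates equal
  to one, and \<open>W\<close> the set of free coordinates in which the deleted vertex has a one.\<close>

lemma subcube_has_all_colors:
  fixes P D W :: "nat set"
  assumes k: "k \<ge> 3" and fin: "finite P" "finite D" and cardP: "card P = 2 * k"
    and disj: "D \<inter> P = {}" and col: "col < (k - 1) * (k + 2)"
  shows "\<exists>p\<in>P. \<exists>S\<subseteq>P - {p}. S \<noteq> W - {p} \<and>
    edge_color k (card {i \<in> D \<union> S. i < p}) (card {i \<in> D \<union> S. p < i}) = col"
proof -
  define lo where "lo p = {q \<in> P. q < p}" for p
  define hi where "hi p = {q \<in> P. p < q}" for p
  have fin': "finite (lo p)" "finite (hi p)" for p
    using fin by (auto simp: lo_def hi_def)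
  define c d where "c = col div (k + 2)" and "d = col mod (k + 2)"
  have cd: "c < k - 1" "d < k + 2" "c * (k + 2) + d = col"
    unfolding c_def d_def using col
    by (simp_all only: less_mult_imp_div_less div_mult_mod_eq mod_less_divisor add_gr_0 zero_less_numeral simp_thms)
  \<comment> \<open>The shift \<open>t\<close> depends on \<open>D\<close> only through its size, so
    it is the same for every direction; the shift \<open>s\<close> below depends on how
    \<open>D\<close> splits at \<open>p\<close>.\<close>
  obtain t where t: "t < k - 1" "(card D + t) mod (k - 1) = c"
    using ex_residue_shift[OF cd(1)] by blast
  define b where "b p = card {i \<in> D. i < p}" for p
  define b' where "b' p = card {i \<in> D. p < i}" for p
  have bb: "b p + b' p = card D" if "p \<in> P" for p
  proof -
    have "D = {i \<in> D. i < p} \<union> {i \<in> D. p < i}"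
      using that disj by force
    then have "card D = card ({i \<in> D. i < p} \<union> {i \<in> D. p < i})"
      by simp
    also have "\<dots> = b p + b' p"
      unfolding b_def b'_def using fin by (intro card_Un_disjoint) auto
    finally show ?thesis by simp
  qed
  have ex_s: "\<exists>s<k + 2. (b p + 2 * ((card D + t) div (k - 1)) + s) mod (k + 2) = d" for p
    using ex_residue_shift[OF cd(2)] by blast
  \<comment> \<open>A suitable grid point yields an edge of colour \<open>col\<close> unless it is a
    corner whose only edge is incident to the deleted vertex.\<close>
  have realize: ?thesis
    if p: "p \<in> P" and xy: "x \<le> card (lo p)" "y \<le> card (hi p)"
      and s: "(b p + 2 * ((card D + t) div (k - 1)) + s) mod (k + 2) = d"
      and eqs: "x + y = t + j * (k - 1)" "(x + 2 * j) mod (k + 2) = s"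
      and av: "\<not> (corner (card (lo p)) (card (hi p)) x y \<and>
                   card (W \<inter> lo p) = x \<and> card (W \<inter> hi p) = y)"
    for p x y j s
  proof -
    have inter: "(W - {p}) \<inter> lo p = W \<inter> lo p" "(W - {p}) \<inter> hi p = W \<inter> hi p"
      by (auto simp: lo_def hi_def)
    have "lo p \<inter> hi p = {}"
      by (auto simp: lo_def hi_def)
    then obtain S where S: "S \<subseteq> lo p \<union> hi p" "card (S \<inter> lo p) = x" "card (S \<inter> hi p) = y"
      "S \<noteq> W - {p}"
      using ex_pair_subset_card_avoiding[OF fin' _ xy, of "W - {p}"] av
      unfolding inter by blast
    have "{i \<in> D \<union> S. i < p} = {i \<in> D. i < p} \<union> (S \<inter> lo p)"
      using S(1) by (auto simp: lo_def hi_def)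
    moreover have "{i \<in> D. i < p} \<inter> (S \<inter> lo p) = {}"
      using disj by (auto simp: lo_def)
    ultimately have l: "card {i \<in> D \<union> S. i < p} = b p + x"
      using S fin fin' by (simp add: card_Un_disjoint b_def)
    have "{i \<in> D \<union> S. p < i} = {i \<in> D. p < i} \<union> (S \<inter> hi p)"
      using S(1) by (auto simp: lo_def hi_def)
    moreover have "{i \<in> D. p < i} \<inter> (S \<inter> hi p) = {}"
      using disj by (auto simp: hi_def)
    ultimately have r: "card {i \<in> D \<union> S. p < i} = b' p + y"
      using S fin fin' by (simp add: card_Un_disjoint b'_def)
    have "edge_color k (b p + x) (b' p + y) = c * (k + 2) + d"
      using k t s eqs bb[OF p] by (intro edge_color_shift[of k _ _ t _ s _ _ _ j]) auto
    moreover have "S \<subseteq> P - {p}"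
      using S(1) by (auto simp: lo_def hi_def)
    ultimately show ?thesis
      using p S(4) l r cd(3) by (intro bexI[of _ p] exI[of _ S]) auto
  qed
  \<comment> \<open>The two middle elements of \<open>P\<close>: with \<open>2 * k\<close> free
    coordinates, \<open>p\<close> has \<open>k - 1\<close> of them below it and \<open>p'\<close>
    has \<open>k\<close>.\<close>
  obtain p where p: "p \<in> P" "card (lo p) = k - 1" "card (hi p) = k"
    using ex_nth_element[OF fin(1), of "k - 1"] cardP k unfolding lo_def hi_def by fastforce
  obtain p' where p': "p' \<in> P" "card (lo p') = k" "card (hi p') = k - 1"
    using ex_nth_element[OF fin(1), of k] cardP k unfolding lo_def hi_def by fastforce
  have "p < p'"
  proof (rule ccontr)
    assume "\<not> p < p'"
    then have "lo p' \<subseteq> lo p"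
      by (auto simp: lo_def)
    then have "card (lo p') \<le> card (lo p)"
      by (intro card_mono fin')
    then show False
      using p p' k by simp
  qed
  then have subs: "lo p \<subseteq> lo p'" "hi p' \<subseteq> hi p"
    by (auto simp: lo_def hi_def)
  \<comment> \<open>\<open>lo p'\<close> exceeds \<open>lo p\<close> by the single coordinate
    \<open>p\<close>.\<close>
  have le_k: "card (A \<inter> lo p') \<le> card (A \<inter> lo p) + 1" for A
  proof -
    have "card (lo p' - lo p) = 1"
      using card_Diff_subset[OF fin'(1) subs(1)] p p' k by simp
    moreover have "A \<inter> lo p' \<subseteq> (A \<inter> lo p) \<union> (lo p' - lo p)"
      by auto
    ultimately show ?thesis
      using card_mono[of "(A \<inter> lo p) \<union> (lo p' - lo p)" "A \<inter> lo p'"]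
        card_Un_le[of "A \<inter> lo p" "lo p' - lo p"] fin' by simp
  qed
  obtain s where s: "s < k + 2" "(b p + 2 * ((card D + t) div (k - 1)) + s) mod (k + 2) = d"
    using ex_s by blast
  obtain s' where s': "s' < k + 2" "(b p' + 2 * ((card D + t) div (k - 1)) + s') mod (k + 2) = d"
    using ex_s by blast
  obtain j x y where c1: "x \<le> k - 1" "y \<le> k" "x + y = t + j * (k - 1)"
      "(x + 2 * j) mod (k + 2) = s"
      "\<not> corner (k - 1) k x y \<or> t = 0 \<and> x = k - 1 \<and> y = 0 \<or> t = 1 \<and> x = 0 \<and> y = k"
    using cells_middle[OF k t(1) s(1)] by blast
  show ?thesis
  proof (cases "corner (k - 1) k x y \<and> card (W \<inter> lo p) = x \<and> card (W \<inter> hi p) = y")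
    case False
    show ?thesis
      by (rule realize[OF p(1) _ _ s(2) c1(3,4)]) (use False p c1 in auto)
  next
    case True
    then consider "t = 0" "card (W \<inter> lo p) = k - 1" "card (W \<inter> hi p) = 0"
      | "t = 1" "card (W \<inter> lo p) = 0" "card (W \<inter> hi p) = k"
      using c1(5) by auto
    then show ?thesis
    proof cases
      case 1
      \<comment> \<open>Here \<open>W\<close> contains all of \<open>lo p\<close> and nothing of
        \<open>hi p\<close>, so the only corner it can block at \<open>p'\<close> is
        \<open>(k, 0)\<close>.\<close>
      have w: "card (W \<inter> lo p') \<ge> k - 1"
        using card_mono[of "W \<inter> lo p'" "W \<inter> lo p"] subs fin' 1 by auto
      obtain j x y where "x \<le> k" "y \<le> k - 1" "x + y = t + j * (k - 1)"
        "(x + 2 * j) mod (k + 2) = s'" "x \<noteq> k \<or> y \<noteq> 0"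
        using cells_next_0[OF k s'(1)] 1 by auto
      moreover have "W \<inter> hi p' = {}"
        using 1 subs fin'(2)[of p] by auto
      ultimately show ?thesis
        using w k p' by (intro realize[OF p'(1) _ _ s'(2)]) (auto simp: corner_def)
    next
      case 2
      \<comment> \<open>Dually, \<open>W\<close> misses \<open>lo p\<close> and contains
        \<open>hi p\<close>. It may contain \<open>p\<close>, whence the bound 1, and the only
        corner it can block at \<open>p'\<close> is \<open>(0, k - 1)\<close>.\<close>
      have w: "card (W \<inter> lo p') \<le> 1"
        using le_k[of W] 2 by simp
      have "W \<inter> hi p = hi p"
        using 2 p fin'(2)[of p] by (intro card_subset_eq) auto
      then have w': "W \<inter> hi p' = hi p'"
        using subs by auto
      obtain j x y where "x \<le> k" "y \<le> k - 1" "x + y = t + j * (k - 1)"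
        "(x + 2 * j) mod (k + 2) = s'" "x \<noteq> 0 \<or> y \<noteq> k - 1"
        using cells_next_1[OF k s'(1)] 2 by auto
      then show ?thesis
        using w w' k p' by (intro realize[OF p'(1) _ _ s'(2)]) (auto simp: corner_def)
    qed
  qed
qed

section \<open>Rigidity of embeddings of the punctured cube\<close>

lemma singleton_psubset:
  assumes "i \<in> I" "card I \<ge> 2"
  shows "{i} \<subset> I"
proof -
  have "{i} \<noteq> I"
    using assms(2) by auto
  then show ?thesis
    using assms(1) by blast
qed

text \<open>The images of the singletons determine the directions \<open>\<pi>\<close>. Every larger
  \<open>S\<close> closes a 4-cycle whose other three vertices are smaller sets, so its image is
  forced by induction on the size. With the deleted vertex at the full set \<open>I\<close>, these
  smaller vertices are always present.\<close>

lemma punctured_cube_embedding: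
  fixes F :: "'a set \<Rightarrow> 'b set"
  assumes fin: "finite I" and two: "card I \<ge> 2"
    and inj: "inj_on F (Pow I - {I})"
    and adj: "\<And>S i. i \<notin> S \<Longrightarrow> insert i S \<subset> I \<Longrightarrow> \<exists>j. sym_diff (F S) (F (insert i S)) = {j}"
  shows "\<exists>\<pi>. inj_on \<pi> I \<and> (\<forall>S. S \<subset> I \<longrightarrow> F S = sym_diff (F {}) (\<pi> ` S))"
proof -
  have single: "{i} \<subset> I" if "i \<in> I" for i
    using singleton_psubset that two by metis
  have "\<exists>j. sym_diff (F {}) (F {i}) = {j}" if "i \<in> I" for i
    using adj[of i "{}"] single[OF that] by simp
  then obtain \<pi> where \<pi>: "\<And>i. i \<in> I \<Longrightarrow> sym_diff (F {}) (F {i}) = {\<pi> i}"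
    by metis
  have F1: "F {i} = sym_diff (F {}) {\<pi> i}" if "i \<in> I" for i
    using \<pi>[OF that] by blast
  have inj\<pi>: "inj_on \<pi> I"
  proof (rule inj_onI)
    fix a b assume ab: "a \<in> I" "b \<in> I" "\<pi> a = \<pi> b"
    then have "F {a} = F {b}"
      using F1 by simp
    then have "{a} = {b}"
      using inj_onD[OF inj, of "{a}" "{b}"] single ab by blast
    then show "a = b" by simp
  qed
  have "F S = sym_diff (F {}) (\<pi> ` S)" if "S \<subset> I" for S
    using that
  proof (induction "card S" arbitrary: S rule: less_induct)
    case less
    have finS: "finite S"
      using less.prems fin finite_subset by blast
    consider "S = {}" | a where "S = {a}" | a b T where "S = insert a (insert b T)" "a \<noteq> b" "a \<notin> T" "b \<notin> T"
      by (metis insert_iff mk_disjoint_insert all_not_in_conv)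
    then show ?case
    proof cases
      case 1
      then show ?thesis by simp
    next
      case 2
      then show ?thesis using F1 less.prems by auto
    next
      case 3
      have I: "a \<in> I" "b \<in> I" "T \<subseteq> I"
        using 3 less.prems by auto
      have IH: "F X = sym_diff (F {}) (\<pi> ` X)" if "X \<subset> S" for X
        using less that psubset_card_mono[OF finS that] by blast
      have sub: "T \<subset> S" "insert a T \<subset> S" "insert b T \<subset> S"
        using 3 by auto
      obtain j where j: "sym_diff (F (insert b T)) (F S) = {j}"
        using adj[of a "insert b T"] 3 less.prems by auto
      obtain j' where j': "sym_diff (F (insert a T)) (F S) = {j'}"
        using adj[of b "insert a T"] 3 less.prems by (auto simp: insert_commute)
      have ne: "F S \<noteq> F T"
        using inj_onD[OF inj, of S T] less.prems sub by blast
      have \<pi>ab: "\<pi> a \<noteq> \<pi> b" "\<pi> a \<notin> \<pi> ` T" "\<pi> b \<notin> \<pi> ` T"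
        using inj\<pi> I 3 by (auto dest: inj_onD)
      define X Z where "X = F T" and "Z = \<pi> ` T"
      note \<pi>ab = \<pi>ab[folded Z_def]
      have FX: "X = sym_diff (F {}) Z"
        using IH[OF sub(1)] by (simp add: X_def Z_def)
      have Fa: "F (insert a T) = sym_diff X {\<pi> a}" and Fb: "F (insert b T) = sym_diff X {\<pi> b}"
        using \<pi>ab unfolding IH[OF sub(2)] IH[OF sub(3)] FX image_insert Z_def[symmetric] by auto
      have e1: "F S = sym_diff (sym_diff X {\<pi> b}) {j}"
        using j unfolding Fb by blast
      have e2: "F S = sym_diff (sym_diff X {\<pi> a}) {j'}"
        using j' unfolding Fa by blast
      \<comment> \<open>Two vertices at distance two have exactly two common neighbours, and \<open>F T\<close> is one.\<close>
      have "sym_diff {\<pi> b} {j} = sym_diff {\<pi> a} {j'}"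
        using e1 e2 by blast
      moreover have "j \<noteq> \<pi> b"
        using e1 ne unfolding X_def by blast
      ultimately have "j = \<pi> a"
        using \<pi>ab by blast
      then have "F S = sym_diff (sym_diff (sym_diff (F {}) Z) {\<pi> b}) {\<pi> a}"
        using e1 FX by simp
      also have "\<dots> = sym_diff (F {}) (insert (\<pi> a) (insert (\<pi> b) Z))"
        using \<pi>ab by auto
      also have "insert (\<pi> a) (insert (\<pi> b) Z) = \<pi> ` S"
        using 3 by (simp add: Z_def)
      finally show ?thesis .
    qed
  qed
  then show ?thesis
    using inj\<pi> by blast
qed

section \<open>Bit strings as sets, and copies as punctured subcubes\<close>

definition ones :: "bool list \<Rightarrow> nat set" where
  "ones u = {i. i < length u \<and> u ! i}"

definition vec :: "nat \<Rightarrow> nat set \<Rightarrow> bool list" where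
  "vec n S = map (\<lambda>i. i \<in> S) [0..<n]"

lemma length_vec [simp]: "length (vec n S) = n"
  by (simp add: vec_def)

lemma vec_nth [simp]: "i < n \<Longrightarrow> vec n S ! i \<longleftrightarrow> i \<in> S"
  by (simp add: vec_def)

lemma ones_subset: "length u = n \<Longrightarrow> ones u \<subseteq> {..<n}"
  by (auto simp: ones_def)

lemma ones_vec: "S \<subseteq> {..<n} \<Longrightarrow> ones (vec n S) = S"
  by (auto simp: ones_def)

lemma vec_ones: "length u = n \<Longrightarrow> vec n (ones u) = u"
  by (auto simp: ones_def intro!: nth_equalityI)

lemma vec_eq_iff: "S \<subseteq> {..<n} \<Longrightarrow> T \<subseteq> {..<n} \<Longrightarrow> vec n S = vec n T \<longleftrightarrow> S = T"
  by (metis ones_vec)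

lemma hypercube_edge_iff:
  "{u, w} \<in> edges (hypercube n) \<longleftrightarrow>
     length u = n \<and> length w = n \<and> (\<exists>j. sym_diff (ones u) (ones w) = {j})"
proof -
  have "{i. i < n \<and> u ! i \<noteq> w ! i} = sym_diff (ones u) (ones w)"
    if "length u = n" "length w = n" for u w
    using that by (auto simp: ones_def)
  then have *: "length u = n \<and> length w = n \<and> card {i. i < n \<and> u ! i \<noteq> w ! i} = 1 \<longleftrightarrow>
      length u = n \<and> length w = n \<and> (\<exists>j. sym_diff (ones u) (ones w) = {j})" for u w
    unfolding One_nat_def card_1_singleton_iff by metis
  have "{u, w} \<in> edges (hypercube n) \<longleftrightarrow> (\<exists>u' w'. {u, w} = {u', w'} \<and>
      length u' = n \<and> length w' = n \<and> (\<exists>j. sym_diff (ones u') (ones w') = {j}))"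
    unfolding hypercube_def using * by simp
  then show ?thesis
    by (auto simp: doubleton_eq_iff Un_commute)
qed

text \<open>Rigidity makes the copy a subcube with free coordinates \<open>P\<close> and fixed ones
  \<open>D\<close>, punctured at \<open>D \<union> W\<close>. The condition
  \<open>S \<noteq> W - {p}\<close> says that neither end of the edge is this vertex.\<close>

lemma punctured_hypercube_embedding:
  assumes emb: "embedding (delete_vertex (hypercube d) v) n H" and v: "length v = d" and d: "d \<ge> 2"
  shows "\<exists>P D W. P \<subseteq> {..<n} \<and> card P = d \<and> D \<subseteq> {..<n} - P \<and>
    (\<forall>p\<in>P. \<forall>S\<subseteq>P - {p}. S \<noteq> W - {p} \<longrightarrow>
       {vec n (D \<union> S), vec n (insert p (D \<union> S))} \<in> edges H)"
proof -
  let ?G = "delete_vertex (hypercube d) v" and ?I = "{..<d}"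
  obtain f where f: "bij_betw f (verts ?G) (verts H)"
    "\<And>u w. u \<in> verts ?G \<Longrightarrow> w \<in> verts ?G \<Longrightarrow> {u, w} \<in> edges ?G \<longleftrightarrow> {f u, f w} \<in> edges H"
    using emb unfolding embedding_def isomorphic_def by blast
  have H: "verts H \<subseteq> verts (hypercube n)" "edges H \<subseteq> edges (hypercube n)"
    using emb unfolding embedding_def subgraph_def by auto
  \<comment> \<open>Translating by \<open>A\<close> moves the deleted vertex \<open>v\<close> to the
    full set, as \<open>punctured_cube_embedding\<close> requires.\<close>
  define A where "A = ?I - ones v"
  define g where "g S = vec d (sym_diff S A)" for S
  have A: "A \<subseteq> ?I"
    by (auto simp: A_def)
  have g_eq: "g S = g T \<longleftrightarrow> S = T" if "S \<subseteq> ?I" "T \<subseteq> ?I" for S T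
  proof -
    have "g S = g T \<longleftrightarrow> sym_diff S A = sym_diff T A"
      unfolding g_def using that A by (intro vec_eq_iff) auto
    then show ?thesis by blast
  qed
  have "sym_diff ?I A = ones v"
    using ones_subset[OF v] by (auto simp: A_def)
  then have gI: "g ?I = v"
    using vec_ones[OF v] by (simp add: g_def)
  have gG: "g S \<in> verts ?G" if "S \<subset> ?I" for S
    using g_eq[of S ?I] that gI by (auto simp: delete_vertex_def hypercube_def g_def)
  have g_edge: "{f (g S), f (g T)} \<in> edges H"
    if "S \<subset> ?I" "T \<subset> ?I" "sym_diff S T = {i}" for S T i
  proof -
    have "ones (g S) = sym_diff S A" "ones (g T) = sym_diff T A"
      unfolding g_def using that A by (intro ones_vec; auto)+
    moreover have "sym_diff (sym_diff S A) (sym_diff T A) = sym_diff S T"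
      by blast
    ultimately have "sym_diff (ones (g S)) (ones (g T)) = {i}"
      using that(3) by simp
    then have "{g S, g T} \<in> edges (hypercube d)"
      unfolding hypercube_edge_iff by (auto simp: g_def)
    moreover have "g S \<noteq> v" "g T \<noteq> v"
      using gG[OF that(1)] gG[OF that(2)] by (auto simp: delete_vertex_def)
    ultimately have "{g S, g T} \<in> edges ?G"
      by (auto simp: delete_vertex_def)
    then show ?thesis
      using f(2) gG that by blast
  qed
  define F where "F S = ones (f (g S))" for S
  have len: "length (f (g S)) = n" if "S \<subset> ?I" for S
    using bij_betwE[OF f(1)] gG[OF that] H(1) by (auto simp: hypercube_def)
  have f_eq: "f (g S) = vec n (F S)" if "S \<subset> ?I" for S
    using vec_ones[OF len[OF that]] by (simp add: F_def)
  have injF: "inj_on F (Pow ?I - {?I})"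
  proof (rule inj_onI)
    fix S T assume ST: "S \<in> Pow ?I - {?I}" "T \<in> Pow ?I - {?I}" "F S = F T"
    then have sub: "S \<subset> ?I" "T \<subset> ?I"
      by blast+
    then have "f (g S) = f (g T)"
      using f_eq ST(3) by simp
    then have "g S = g T"
      using inj_onD[OF bij_betw_imp_inj_on[OF f(1)]] gG sub by blast
    then show "S = T"
      using g_eq sub by blast
  qed
  have adjF: "\<exists>j. sym_diff (F S) (F (insert i S)) = {j}" if "i \<notin> S" "insert i S \<subset> ?I" for S i
  proof -
    have "{f (g S), f (g (insert i S))} \<in> edges H"
    proof (rule g_edge)
      show "S \<subset> ?I" "insert i S \<subset> ?I" "sym_diff S (insert i S) = {i}"
        using that by blast+
    qed
    then show ?thesis
      using H(2) hypercube_edge_iff unfolding F_def by blast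
  qed
  have "card ?I \<ge> 2"
    using d by simp
  from punctured_cube_embedding[OF finite_lessThan this injF adjF]
  obtain \<pi> where \<pi>: "inj_on \<pi> ?I" "\<And>S. S \<subset> ?I \<Longrightarrow> F S = sym_diff (F {}) (\<pi> ` S)"
    by blast
  define P where "P = \<pi> ` ?I"
  have empty: "{} \<subset> ?I"
    using d lessThan_empty_iff[of d] by fastforce
  have F0: "F {} \<subseteq> {..<n}"
    unfolding F_def using ones_subset[OF len[OF empty]] .
  have "\<pi> i < n" if "i < d" for i
  proof -
    have i: "{i} \<subset> ?I"
      using that d by (intro singleton_psubset) auto
    have "F {i} \<subseteq> {..<n}"
      unfolding F_def using ones_subset[OF len[OF i]] .
    then show ?thesis
      using \<pi>(2)[OF i] F0 by auto
  qed
  then have P: "P \<subseteq> {..<n}" "card P = d"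
    using card_image[OF \<pi>(1)] by (auto simp: P_def)
  \<comment> \<open>The full set would be sent to \<open>sym_diff (F {}) P\<close>, which is
    \<open>D \<union> W\<close>: this is the missing vertex.\<close>
  define D W where "D = F {} - P" and "W = P - F {}"
  \<comment> \<open>Inverts \<open>F\<close> on the subcube: translate back by \<open>F {}\<close>,
    then pull back along \<open>\<pi>\<close>.\<close>
  define pre where "pre Y = {i \<in> ?I. \<pi> i \<in> sym_diff Y (F {})}" for Y
  have pre: "pre (D \<union> S) \<subset> ?I \<and> F (pre (D \<union> S)) = D \<union> S" if S: "S \<subseteq> P" "S \<noteq> W" for S
  proof -
    have im: "\<pi> ` pre (D \<union> S) = sym_diff (D \<union> S) (F {})"
      using S by (auto simp: pre_def P_def D_def)
    have "pre (D \<union> S) \<noteq> ?I"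
    proof
      assume "pre (D \<union> S) = ?I"
      then have "sym_diff (D \<union> S) (F {}) = P"
        using im by (simp add: P_def)
      then show False
        using S by (auto simp: D_def W_def)
    qed
    then have lt: "pre (D \<union> S) \<subset> ?I"
      by (auto simp: pre_def)
    have "F (pre (D \<union> S)) = sym_diff (F {}) (sym_diff (D \<union> S) (F {}))"
      using \<pi>(2)[OF lt] unfolding im .
    also have "\<dots> = D \<union> S"
      by blast
    finally show ?thesis
      using lt by blast
  qed
  have "{vec n (D \<union> S), vec n (insert p (D \<union> S))} \<in> edges H"
    if p: "p \<in> P" "S \<subseteq> P - {p}" "S \<noteq> W - {p}" for p S
  proof -
    have S: "S \<subseteq> P" "S \<noteq> W" "insert p S \<subseteq> P" "insert p S \<noteq> W"
      using p by auto
    obtain i where i: "i \<in> ?I" "p = \<pi> i"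
      using p by (auto simp: P_def)
    have "p \<notin> D \<union> S"
      using p by (auto simp: D_def)
    then have "sym_diff (sym_diff (D \<union> S) (F {})) (sym_diff (D \<union> insert p S) (F {})) = {p}"
      by auto
    then have "sym_diff (pre (D \<union> S)) (pre (D \<union> insert p S)) = {x \<in> ?I. \<pi> x \<in> {p}}"
      unfolding pre_def by blast
    also have "\<dots> = {i}"
      using i \<pi>(1) by (auto dest: inj_onD)
    finally have "sym_diff (pre (D \<union> S)) (pre (D \<union> insert p S)) = {i}" .
    then have "{f (g (pre (D \<union> S))), f (g (pre (D \<union> insert p S)))} \<in> edges H"
      using g_edge[OF conjunct1[OF pre[OF S(1,2)]] conjunct1[OF pre[OF S(3,4)]]] by blast
    then show ?thesis
      using pre[OF S(1,2)] pre[OF S(3,4)] f_eq by simp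
  qed
  then show ?thesis
    using P F0 by (intro exI[of _ P] exI[of _ D] exI[of _ W]) (auto simp: D_def)
qed

section \<open>The colouring of hypercube edges\<close>

definition edge_dir :: "bool list set \<Rightarrow> nat" where
  "edge_dir e = (THE j. \<exists>u\<in>e. \<exists>w\<in>e. j \<in> ones u - ones w)"

text \<open>An edge is an unordered pair; intersecting the sets of ones of its ends recovers the
  lower end, which has a zero in the direction of the edge.\<close>

definition coloring :: "nat \<Rightarrow> bool list set \<Rightarrow> nat" where
  "coloring k e = edge_color k (card {i \<in> \<Inter> (ones ` e). i < edge_dir e})
                               (card {i \<in> \<Inter> (ones ` e). edge_dir e < i})"

lemma coloring_vec:
  assumes "Y \<subseteq> {..<n}" "p < n" "p \<notin> Y"
  shows "coloring k {vec n Y, vec n (insert p Y)} = edge_color k (card {i \<in> Y. i < p}) (card {i \<in> Y. p < i})"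
proof -
  have o: "ones (vec n Y) = Y" "ones (vec n (insert p Y)) = insert p Y"
    using assms by (auto intro!: ones_vec)
  have "edge_dir {vec n Y, vec n (insert p Y)} = p"
    unfolding edge_dir_def using assms by (intro the_equality) (auto simp: o)
  moreover have "\<Inter> (ones ` {vec n Y, vec n (insert p Y)}) = Y"
    by (auto simp: o)
  ultimately show ?thesis
    by (simp add: coloring_def)
qed

lemma coloring_polychromatic:
  assumes k: "k \<ge> 3" and v: "length v = 2 * k"
  shows "polychromatic_coloring (delete_vertex (hypercube (2 * k)) v) ((k - 1) * (k + 2)) n (coloring k)"
  unfolding polychromatic_coloring_def
proof (intro conjI ballI allI impI)
  fix e show "coloring k e < (k - 1) * (k + 2)"
    unfolding coloring_def using k by (intro edge_color_less) simp
next
  fix H col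
  assume H: "embedding (delete_vertex (hypercube (2 * k)) v) n H" and col: "col < (k - 1) * (k + 2)"
  have "2 * k \<ge> 2"
    using k by simp
  from punctured_hypercube_embedding[OF H v this]
  obtain P D W where P: "P \<subseteq> {..<n}" "card P = 2 * k" "D \<subseteq> {..<n} - P"
    "\<forall>p\<in>P. \<forall>S\<subseteq>P - {p}. S \<noteq> W - {p} \<longrightarrow>
       {vec n (D \<union> S), vec n (insert p (D \<union> S))} \<in> edges H"
    by (elim exE conjE)
  have "finite P" "finite D" "D \<inter> P = {}"
    using P(1,3) by (blast intro: finite_subset[OF _ finite_lessThan[of n]])+
  then obtain p S where pS: "p \<in> P" "S \<subseteq> P - {p}" "S \<noteq> W - {p}"
    "edge_color k (card {i \<in> D \<union> S. i < p}) (card {i \<in> D \<union> S. p < i}) = col"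
    using subcube_has_all_colors[OF k _ _ P(2) _ col] by metis
  have "coloring k {vec n (D \<union> S), vec n (insert p (D \<union> S))} = col"
    using coloring_vec[of "D \<union> S" n p k] pS P by auto
  then show "\<exists>e\<in>edges H. coloring k e = col"
    using P(4) pS(1-3) by blast
qed

section \<open>Boundedness of the admissible numbers of colours\<close>

lemma finite_edges_hypercube: "finite (edges (hypercube n))"
proof -
  have "finite {u :: bool list. length u = n}"
    using finite_lists_length_eq[of "UNIV :: bool set" n] by simp
  moreover have "edges (hypercube n) \<subseteq> Pow {u. length u = n}"
    by (auto simp: hypercube_def)
  ultimately show ?thesis
    using finite_subset by blast
qed

lemma embedding_delete_vertex_hypercube:
  "embedding (delete_vertex (hypercube n) v) n (delete_vertex (hypercube n) v)"
proof -
  have "e \<subseteq> {u. length u = n} \<and> card e = 2" if edge: "e \<in> edges (hypercube n)" for e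
  proof -
    obtain u w where e: "e = {u, w}" "length u = n" "length w = n"
      "card {i. i < n \<and> u ! i \<noteq> w ! i} = 1"
      using edge unfolding hypercube_def ugraph.simps by blast
    then have "u \<noteq> w" by auto
    then show ?thesis using e by simp
  qed
  then have "subgraph (delete_vertex (hypercube n) v) (hypercube n)"
    by (fastforce simp: subgraph_def simple_graph_def delete_vertex_def hypercube_def)
  moreover have "isomorphic (delete_vertex (hypercube n) v) (delete_vertex (hypercube n) v)"
    unfolding isomorphic_def by (intro exI[of _ id]) auto
  ultimately show ?thesis
    by (simp add: embedding_def)
qed

text \<open>Different colours need different edges of one copy. This bound makes the
  \<open>GREATEST\<close> in \<open>polychromatic_number\<close> meaningful.\<close>

lemma polychromatic_coloring_le_card_edges:
  assumes "polychromatic_coloring G r n c" "embedding G n H" "finite (edges H)"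
  shows "r \<le> card (edges H)"
proof -
  have "{..<r} \<subseteq> c ` edges H"
    using assms(1,2) unfolding polychromatic_coloring_def by force
  then have "card {..<r} \<le> card (edges H)"
    using assms(3) surj_card_le by blast
  then show ?thesis by simp
qed

theorem theorem14:
  fixes k :: nat and v :: "bool list"
  assumes "k \<ge> 3"
    and "v \<in> verts (hypercube (2 * k))"
  shows "polychromatic_number (delete_vertex (hypercube (2 * k)) v) \<ge> k\<^sup>2 + k - 2
         \<and> k\<^sup>2 + k - 2 = (k - 1) * (k + 2)"
proof -
  let ?G = "delete_vertex (hypercube (2 * k)) v"
  have v: "length v = 2 * k"
    using assms(2) by (simp add: hypercube_def)
  have eq: "k\<^sup>2 + k - 2 = (k - 1) * (k + 2)"
    by (cases k) (simp_all add: power2_eq_square)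
  have "(k - 1) * (k + 2) \<le> polychromatic_number ?G"
    unfolding polychromatic_number_def
  proof (rule Greatest_le_nat)
    show "\<forall>n\<ge>1. (\<exists>H. embedding ?G n H) \<longrightarrow>
        (\<exists>c. polychromatic_coloring ?G ((k - 1) * (k + 2)) n c)"
      using coloring_polychromatic[OF assms(1) v] by blast
  next
    fix r
    assume r: "\<forall>n\<ge>1. (\<exists>H. embedding ?G n H) \<longrightarrow> (\<exists>c. polychromatic_coloring ?G r n c)"
    \<comment> \<open>The bound is taken in dimension \<open>2 * k\<close>, where the punctured cube
      is a copy of itself.\<close>
    have "2 * k \<ge> 1"
      using assms(1) by simp
    then obtain c where "polychromatic_coloring ?G r (2 * k) c"
      using r embedding_delete_vertex_hypercube by blast
    moreover have "finite (edges ?G)"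
      using finite_edges_hypercube by (simp add: delete_vertex_def)
    ultimately show "r \<le> card (edges ?G)"
      using polychromatic_coloring_le_card_edges embedding_delete_vertex_hypercube by blast
  qed
  then show ?thesis
    using eq by simp
qed

end
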